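(* Let $n\geq1$ and let $\mathcal{F}_n$ be the family of unions of $n$ lines in $\mathbb{R}^2$. (1) If $P\subseteq\mathbb{R}^2$ contains $n+2$ distinct collinear points, then $P$ is not shattered by $\mathcal{F}_n$. (2) If $P\subseteq\mathbb{R}^2$ is shattered by $\mathcal{F}_n$, then there are lines $L_1,\dots,L_n$ with $P\subseteq L_1\cup\dots\cup L_n$. (3) If $A,B\subseteq\mathbb{R}^2$ are disjoint and each consists of $n+1$ collinear points, then $A\cup B$ is not shattered by $\mathcal{F}_n$.
   Context: A family $\mathcal{S}$ shatters $P$ if for every $Z\subseteq P$ there is $S\in\mathcal{S}$ with $S\cap P=Z$. *)

theory Defs
  imports "HOL-Analysis.Analysis"
begin

definition shatters :: "'a set set \<Rightarrow> 'a set \<Rightarrow> bool" where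
  "shatters \<S> P \<longleftrightarrow> (\<forall>Z. Z \<subseteq> P \<longrightarrow> (\<exists>S\<in>\<S>. S \<inter> P = Z))"

definition is_line :: "(real ^ 2) set \<Rightarrow> bool" where
  "is_line L \<longleftrightarrow> affine L \<and> aff_dim L = 1"

text \<open>The lines are indexed and need not be distinct.\<close>

definition line_unions :: "nat \<Rightarrow> (real ^ 2) set set" where
  "line_unions n = {\<Union>i\<in>{1..n}. L i | L. \<forall>i\<in>{1..n}. is_line (L i)}"

end

theory Submission imports Defs begin

text \<open>By pigeonhole, $n$ lines covering more than $n$ points of a collinear set must include a
  line through two of them, which then contains the whole collinear set; this gives (1) by deleting
  one of the $n+2$ points. For (3), delete a suitable point $x$ of $A$: covering $B$ already uses up
  the line spanned by $B$. If $A$ meets that line, delete such a point $x$. Otherwise the remaining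
  $n-1$ lines must cover the $n$ points of $A$ without $x$, so one of them contains $A$ and hence $x$.\<close>

lemma collinear_subset_affine_hull_2:
  fixes Q :: "'a::euclidean_space set"
  assumes "collinear Q" "x \<in> Q" "y \<in> Q" "x \<noteq> y"
  shows "Q \<subseteq> affine hull {x, y}"
proof
  fix z assume "z \<in> Q"
  then have "collinear {x, y, z}"
    using assms by (intro collinear_subset[OF assms(1)]) auto
  then show "z \<in> affine hull {x, y}"
    using assms(4) by (simp add: collinear_3_affine_hull)
qed

lemma collinear_subset_affine_member_if_card_less:
  fixes Q :: "'a::euclidean_space set"
  assumes "finite I" and affine: "\<And>i. i \<in> I \<Longrightarrow> affine (L i)"
    and "collinear Q" "Z \<subseteq> Q" "card I < card Z" and cover: "Z \<subseteq> (\<Union>i\<in>I. L i)"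
  obtains i where "i \<in> I" "Q \<subseteq> L i"
proof -
  from cover have "\<forall>z\<in>Z. \<exists>i. i \<in> I \<and> z \<in> L i" by blast
  then obtain f where f: "\<And>z. z \<in> Z \<Longrightarrow> f z \<in> I \<and> z \<in> L (f z)" by metis
  then have "card (f ` Z) \<le> card I" using \<open>finite I\<close> by (intro card_mono) auto
  then have "\<not> inj_on f Z" using \<open>card I < card Z\<close> card_image[of f Z] by auto
  then obtain x y where xy: "x \<in> Z" "y \<in> Z" "x \<noteq> y" "f x = f y"
    by (auto simp: inj_on_def)
  have "Q \<subseteq> affine hull {x, y}"
    using \<open>collinear Q\<close> \<open>Z \<subseteq> Q\<close> xy by (intro collinear_subset_affine_hull_2) auto
  \<comment> \<open>Since \<open>f x = f y\<close>, both points lie in the affine set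
    \<open>L (f x)\<close>.\<close>
  also have "\<dots> \<subseteq> L (f x)"
    using f[OF xy(1)] f[OF xy(2)] xy(4) affine by (intro hull_minimal) auto
  finally show thesis using that f[OF xy(1)] by blast
qed

lemma is_line_affine: "is_line L \<Longrightarrow> affine L"
  by (simp add: is_line_def)

lemma is_line_collinear: "is_line L \<Longrightarrow> collinear L"
  by (simp add: is_line_def collinear_aff_dim)

lemma shatters_line_unionsE:
  assumes "shatters (line_unions n) P" "Z \<subseteq> P"
  obtains L where "\<forall>i\<in>{1..n}. is_line (L i)" "(\<Union>i\<in>{1..n}. L i) \<inter> P = Z"
proof -
  from assms obtain S where S: "S \<in> line_unions n" "S \<inter> P = Z"
    unfolding shatters_def by blast
  from S(1) obtain L where "S = (\<Union>i\<in>{1..n}. L i)" "\<forall>i\<in>{1..n}. is_line (L i)"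
    unfolding line_unions_def by blast
  with S(2) that[of L] show thesis by simp
qed

lemma not_shatters_line_unions_collinear:
  assumes "Q \<subseteq> P" "card Q = n + 2" "collinear Q"
  shows "\<not> shatters (line_unions n) P"
proof
  assume sh: "shatters (line_unions n) P"
  obtain q where "q \<in> Q" using assms(2) by fastforce
  \<comment> \<open>The trace to realise has \<open>n + 1\<close> points, one more than there are
    lines.\<close>
  have "Q - {q} \<subseteq> P" using assms(1) by blast
  from sh this obtain L where L: "\<forall>i\<in>{1..n}. is_line (L i)"
      and LP: "(\<Union>i\<in>{1..n}. L i) \<inter> P = Q - {q}"
    by (rule shatters_line_unionsE)
  from L have aff: "affine (L i)" if "i \<in> {1..n}" for i
    using is_line_affine that by blast
  have less: "card {1..n} < card (Q - {q})" using \<open>q \<in> Q\<close> assms(2) by simp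
  have "Q - {q} \<subseteq> (\<Union>i\<in>{1..n}. L i)" using LP by blast
  from finite_atLeastAtMost aff assms(3) Diff_subset less this
  obtain i where "i \<in> {1..n}" "Q \<subseteq> L i"
    by (rule collinear_subset_affine_member_if_card_less)
  with LP \<open>q \<in> Q\<close> \<open>Q \<subseteq> P\<close> show False by blast
qed

lemma not_shatters_line_unions_two_collinear:
  assumes "n \<ge> 1" "A \<inter> B = {}" "card A = n + 1" "collinear A" "card B = n + 1" "collinear B"
  shows "\<not> shatters (line_unions n) (A \<union> B)"
proof
  assume sh: "shatters (line_unions n) (A \<union> B)"
  \<comment> \<open>Take \<open>x\<close> on the span of \<open>B\<close> if \<open>A\<close> meets
    it, and any point of \<open>A\<close> otherwise.\<close>
  obtain x where x: "x \<in> A" and x_hull: "x \<in> affine hull B \<or> A \<inter> affine hull B = {}"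
  proof (cases "A \<inter> affine hull B = {}")
    case True
    moreover obtain a where "a \<in> A" using assms(3) by fastforce
    ultimately show thesis using that by blast
  qed (use that in blast)
  from sh Diff_subset[of _ "{x}"] obtain L where L: "\<forall>i\<in>{1..n}. is_line (L i)"
      and LP: "(\<Union>i\<in>{1..n}. L i) \<inter> (A \<union> B) = A \<union> B - {x}"
    by (rule shatters_line_unionsE)
  from L have aff: "affine (L j)" if "j \<in> {1..n}" for j
    using is_line_affine that by blast
  have x_notin: "x \<notin> L j" if "j \<in> {1..n}" for j
    using LP x that by blast
  have less_B: "card {1..n} < card B" using assms(5) by simp
  \<comment> \<open>As \<open>x\<close> lies in \<open>A\<close>, which is disjoint from
    \<open>B\<close>, deleting it costs \<open>B\<close> no point.\<close>
  have "B \<subseteq> (\<Union>i\<in>{1..n}. L i)" using LP x assms(2) by blast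
  from finite_atLeastAtMost aff assms(6) subset_refl less_B this
  obtain i where i: "i \<in> {1..n}" "B \<subseteq> L i"
    by (rule collinear_subset_affine_member_if_card_less)
  have "affine hull B \<subseteq> L i"
    using i aff by (intro hull_minimal) auto
  \<comment> \<open>No line passes through \<open>x\<close>, so \<open>x\<close> is not in
    \<open>affine hull B\<close>; the choice of \<open>x\<close> leaves only the second
    case.\<close>
  with x_notin i(1) x_hull have disj: "A \<inter> affine hull B = {}" by blast
  \<comment> \<open>From \<open>n \<ge> 1\<close>, \<open>B\<close> has at least two points. They
    determine \<open>L i\<close>, so \<open>L i\<close> is no larger than the span of
    \<open>B\<close> and misses \<open>A\<close>.\<close>
  have "\<not> is_singleton B" "B \<noteq> {}"
    using assms(1,5) by (auto simp: is_singleton_altdef)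
  then obtain u v where uv: "u \<in> B" "v \<in> B" "u \<noteq> v"
    by (meson is_singletonI' ex_in_conv)
  have "L i \<subseteq> affine hull {u, v}"
    using L i uv by (intro collinear_subset_affine_hull_2 is_line_collinear) auto
  also have "\<dots> \<subseteq> affine hull B" using uv by (intro hull_mono) auto
  finally have "A \<inter> L i = {}" using disj by blast
  then have cover: "A - {x} \<subseteq> (\<Union>j\<in>{1..n} - {i}. L j)" using LP by blast
  \<comment> \<open>Here \<open>n - 1\<close> lines remain for \<open>n\<close> points.\<close>
  have less: "card ({1..n} - {i}) < card (A - {x})"
    using i(1) x assms(1,3) by simp
  from finite_Diff[OF finite_atLeastAtMost] aff[OF DiffD1] assms(4) Diff_subset less cover
  obtain j where "j \<in> {1..n} - {i}" "A \<subseteq> L j"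
    by (rule collinear_subset_affine_member_if_card_less)
  with x x_notin show False by blast
qed

theorem lemma4p11:
  fixes n :: nat
  assumes "n \<ge> 1"
  shows
    "(\<forall>P :: (real ^ 2) set. (\<exists>Q \<subseteq> P. card Q = n + 2 \<and> collinear Q)
        \<longrightarrow> \<not> shatters (line_unions n) P)
     \<and> (\<forall>P :: (real ^ 2) set. shatters (line_unions n) P
        \<longrightarrow> (\<exists>L :: nat \<Rightarrow> (real ^ 2) set.
              (\<forall>i\<in>{1..n}. is_line (L i)) \<and> P \<subseteq> (\<Union>i\<in>{1..n}. L i)))
     \<and> (\<forall>A B :: (real ^ 2) set. A \<inter> B = {}
          \<and> card A = n + 1 \<and> collinear A \<and> card B = n + 1 \<and> collinear B
        \<longrightarrow> \<not> shatters (line_unions n) (A \<union> B))"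
proof (intro conjI allI impI)
  fix P :: "(real ^ 2) set"
  assume "\<exists>Q \<subseteq> P. card Q = n + 2 \<and> collinear Q"
  then show "\<not> shatters (line_unions n) P"
    using not_shatters_line_unions_collinear by blast
next
  fix P :: "(real ^ 2) set"
  assume "shatters (line_unions n) P"
  \<comment> \<open>The trace chosen is \<open>P\<close> itself, which forces the union to cover
    \<open>P\<close>.\<close>
  from this subset_refl obtain L
    where "\<forall>i\<in>{1..n}. is_line (L i)" "(\<Union>i\<in>{1..n}. L i) \<inter> P = P"
    by (rule shatters_line_unionsE)
  then show "\<exists>L. (\<forall>i\<in>{1..n}. is_line (L i)) \<and> P \<subseteq> (\<Union>i\<in>{1..n}. L i)"
    by blast
next
  fix A B :: "(real ^ 2) set"
  assume "A \<inter> B = {} \<and> card A = n + 1 \<and> collinear A \<and> card B = n + 1 \<and> collinear B"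
  then show "\<not> shatters (line_unions n) (A \<union> B)"
    using not_shatters_line_unions_two_collinear assms by blast
qed

end
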